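(* Consider a logical system $\vdash'$ in the language $\mathcal{L}$ satisfying the axioms of classical logic and (MP). The following are equivalent: (1) $\vdash'$ satisfies (L1)–(L4) and (C); (2) $\vdash'$ satisfies (L1)–(L3) and the rule (DWC$_2$). The same holds replacing (C) and (DWC$_2$) with their weaker versions (wC) and (wDWC$_2$).
   Context: $\mathcal L$ is the language of classical propositional logic $\{\land,\lor,\to,0,1\}$ expanded with a binary connective $\mathbin{\Box\!\!\rightarrow}$. The axioms are: (L1) $\varphi\mathbin{\Box\!\!\rightarrow}\varphi$; (L2) $((\varphi\mathbin{\Box\!\!\rightarrow}\psi)\wedge(\psi\mathbin{\Box\!\!\rightarrow}\varphi))\to((\varphi\mathbin{\Box\!\!\rightarrow}\gamma)\leftrightarrow(\psi\mathbin{\Box\!\!\rightarrow}\gamma))$; (L3) $((\varphi\vee\psi)\mathbin{\Box\!\!\rightarrow}\varphi)\vee((\varphi\vee\psi)\mathbin{\Box\!\!\rightarrow}\psi)\vee(((\varphi\vee\psi)\mathbin{\Box\!\!\rightarrow}\gamma)\leftrightarrow((\varphi\mathbin{\Box\!\!\rightarrow}\gamma)\wedge(\psi\mathbin{\Box\!\!\rightarrow}\gamma)))$; (L4) $(\varphi\mathbin{\Box\!\!\rightarrow}(\psi\land\gamma))\leftrightarrow((\varphi\mathbin{\Box\!\!\rightarrow}\psi)\land(\varphi\mathbin{\Box\!\!\rightarrow}\gamma))$. (MP) is $\varphi,\varphi\to\psi\vdash'\psi$. The rules are: (C) $\varphi\to\psi\vdash'(\gamma\mathbin{\Box\!\!\rightarrow}\varphi)\to(\gamma\mathbin{\Box\!\!\rightarrow}\psi)$;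 (wC) if $\vdash'\varphi\to\psi$ then $\vdash'(\gamma\mathbin{\Box\!\!\rightarrow}\varphi)\to(\gamma\mathbin{\Box\!\!\rightarrow}\psi)$; (DWC$_2$) $(\varphi_1\wedge\varphi_2)\to\psi\vdash'((\gamma\mathbin{\Box\!\!\rightarrow}\varphi_1)\wedge(\gamma\mathbin{\Box\!\!\rightarrow}\varphi_2))\to(\gamma\mathbin{\Box\!\!\rightarrow}\psi)$; (wDWC$_2$) if $\vdash'(\varphi_1\wedge\varphi_2)\to\psi$ then $\vdash'((\gamma\mathbin{\Box\!\!\rightarrow}\varphi_1)\wedge(\gamma\mathbin{\Box\!\!\rightarrow}\varphi_2))\to(\gamma\mathbin{\Box\!\!\rightarrow}\psi)$. *)

theory Defs
  imports Main
begin

datatype 'v fm =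
    Var 'v
  | Bot  (\<open>\<^bold>0\<close>)
  | Top  (\<open>\<^bold>1\<close>)
  | Conj "'v fm" "'v fm"  (infixr \<open>\<^bold>\<and>\<close> 65)
  | Disj "'v fm" "'v fm"  (infixr \<open>\<^bold>\<or>\<close> 60)
  | Impl "'v fm" "'v fm"  (infixr \<open>\<^bold>\<rightarrow>\<close> 55)
  | Cond "'v fm" "'v fm"  (infix \<open>\<box>\<rightarrow>\<close> 70)

abbreviation Iff :: "'v fm \<Rightarrow> 'v fm \<Rightarrow> 'v fm"  (infix \<open>\<^bold>\<leftrightarrow>\<close> 50) where
  "\<phi> \<^bold>\<leftrightarrow> \<psi> \<equiv> (\<phi> \<^bold>\<rightarrow> \<psi>) \<^bold>\<and> (\<psi> \<^bold>\<rightarrow> \<phi>)"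

primrec subst :: "('v \<Rightarrow> 'v fm) \<Rightarrow> 'v fm \<Rightarrow> 'v fm" where
  "subst \<sigma> (Var p) = \<sigma> p"
| "subst \<sigma> \<^bold>0 = \<^bold>0"
| "subst \<sigma> \<^bold>1 = \<^bold>1"
| "subst \<sigma> (\<phi> \<^bold>\<and> \<psi>) = subst \<sigma> \<phi> \<^bold>\<and> subst \<sigma> \<psi>"
| "subst \<sigma> (\<phi> \<^bold>\<or> \<psi>) = subst \<sigma> \<phi> \<^bold>\<or> subst \<sigma> \<psi>"
| "subst \<sigma> (\<phi> \<^bold>\<rightarrow> \<psi>) = subst \<sigma> \<phi> \<^bold>\<rightarrow> subst \<sigma> \<psi>"
| "subst \<sigma> (\<phi> \<box>\<rightarrow> \<psi>) = subst \<sigma> \<phi> \<box>\<rightarrow> subst \<sigma> \<psi>"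

text \<open>A logical system is a substitution-invariant consequence relation;
  \<open>\<Gamma> \<turnstile> \<phi>\<close> is written \<open>D \<Gamma> \<phi>\<close>. It need not be finitary.\<close>

locale logical_system =
  fixes D :: "'v fm set \<Rightarrow> 'v fm \<Rightarrow> bool"
  assumes reflexivity: "\<phi> \<in> \<Gamma> \<Longrightarrow> D \<Gamma> \<phi>"
    and monotonicity: "D \<Gamma> \<phi> \<Longrightarrow> \<Gamma> \<subseteq> \<Delta> \<Longrightarrow> D \<Delta> \<phi>"
    and cut: "(\<And>\<psi>. \<psi> \<in> \<Delta> \<Longrightarrow> D \<Gamma> \<psi>) \<Longrightarrow> D \<Delta> \<phi> \<Longrightarrow> D \<Gamma> \<phi>"
    and structurality: "D \<Gamma> \<phi> \<Longrightarrow> D (subst \<sigma> ` \<Gamma>) (subst \<sigma> \<phi>)"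

text \<open>A standard Hilbert-style axiomatization of classical logic, complete together with
  modus ponens; the negation of \<open>\<phi>\<close> is \<open>\<phi> \<^bold>\<rightarrow> \<^bold>0\<close>. The schematic letters
  range over all formulas, including those containing \<open>\<box>\<rightarrow>\<close>.\<close>

inductive classical_axiom :: "'v fm \<Rightarrow> bool" where
  Impl_K: "classical_axiom (\<phi> \<^bold>\<rightarrow> \<psi> \<^bold>\<rightarrow> \<phi>)"
| Impl_S: "classical_axiom ((\<phi> \<^bold>\<rightarrow> \<psi> \<^bold>\<rightarrow> \<gamma>) \<^bold>\<rightarrow> (\<phi> \<^bold>\<rightarrow> \<psi>) \<^bold>\<rightarrow> \<phi> \<^bold>\<rightarrow> \<gamma>)"
| Conj_E1: "classical_axiom (\<phi> \<^bold>\<and> \<psi> \<^bold>\<rightarrow> \<phi>)"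
| Conj_E2: "classical_axiom (\<phi> \<^bold>\<and> \<psi> \<^bold>\<rightarrow> \<psi>)"
| Conj_I: "classical_axiom (\<phi> \<^bold>\<rightarrow> \<psi> \<^bold>\<rightarrow> \<phi> \<^bold>\<and> \<psi>)"
| Disj_I1: "classical_axiom (\<phi> \<^bold>\<rightarrow> \<phi> \<^bold>\<or> \<psi>)"
| Disj_I2: "classical_axiom (\<psi> \<^bold>\<rightarrow> \<phi> \<^bold>\<or> \<psi>)"
| Disj_E: "classical_axiom ((\<phi> \<^bold>\<rightarrow> \<gamma>) \<^bold>\<rightarrow> (\<psi> \<^bold>\<rightarrow> \<gamma>) \<^bold>\<rightarrow> \<phi> \<^bold>\<or> \<psi> \<^bold>\<rightarrow> \<gamma>)"
| Bot_E: "classical_axiom (\<^bold>0 \<^bold>\<rightarrow> \<phi>)"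
| Top_I: "classical_axiom \<^bold>1"
| Excl_Mid: "classical_axiom (\<phi> \<^bold>\<or> (\<phi> \<^bold>\<rightarrow> \<^bold>0))"

definition satisfies_classical :: "('v fm set \<Rightarrow> 'v fm \<Rightarrow> bool) \<Rightarrow> bool" where
  "satisfies_classical D \<longleftrightarrow> (\<forall>\<phi>. classical_axiom \<phi> \<longrightarrow> D {} \<phi>)"

definition satisfies_MP :: "('v fm set \<Rightarrow> 'v fm \<Rightarrow> bool) \<Rightarrow> bool" where
  "satisfies_MP D \<longleftrightarrow> (\<forall>\<phi> \<psi>. D {\<phi>, \<phi> \<^bold>\<rightarrow> \<psi>} \<psi>)"

definition satisfies_L1 :: "('v fm set \<Rightarrow> 'v fm \<Rightarrow> bool) \<Rightarrow> bool" where
  "satisfies_L1 D \<longleftrightarrow> (\<forall>\<phi>. D {} (\<phi> \<box>\<rightarrow> \<phi>))"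

definition satisfies_L2 :: "('v fm set \<Rightarrow> 'v fm \<Rightarrow> bool) \<Rightarrow> bool" where
  "satisfies_L2 D \<longleftrightarrow> (\<forall>\<phi> \<psi> \<gamma>.
     D {} (((\<phi> \<box>\<rightarrow> \<psi>) \<^bold>\<and> (\<psi> \<box>\<rightarrow> \<phi>)) \<^bold>\<rightarrow> ((\<phi> \<box>\<rightarrow> \<gamma>) \<^bold>\<leftrightarrow> (\<psi> \<box>\<rightarrow> \<gamma>))))"

definition satisfies_L3 :: "('v fm set \<Rightarrow> 'v fm \<Rightarrow> bool) \<Rightarrow> bool" where
  "satisfies_L3 D \<longleftrightarrow> (\<forall>\<phi> \<psi> \<gamma>.
     D {} (((\<phi> \<^bold>\<or> \<psi>) \<box>\<rightarrow> \<phi>) \<^bold>\<or> ((\<phi> \<^bold>\<or> \<psi>) \<box>\<rightarrow> \<psi>) \<^bold>\<or>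
           (((\<phi> \<^bold>\<or> \<psi>) \<box>\<rightarrow> \<gamma>) \<^bold>\<leftrightarrow> ((\<phi> \<box>\<rightarrow> \<gamma>) \<^bold>\<and> (\<psi> \<box>\<rightarrow> \<gamma>)))))"

definition satisfies_L4 :: "('v fm set \<Rightarrow> 'v fm \<Rightarrow> bool) \<Rightarrow> bool" where
  "satisfies_L4 D \<longleftrightarrow> (\<forall>\<phi> \<psi> \<gamma>.
     D {} ((\<phi> \<box>\<rightarrow> (\<psi> \<^bold>\<and> \<gamma>)) \<^bold>\<leftrightarrow> ((\<phi> \<box>\<rightarrow> \<psi>) \<^bold>\<and> (\<phi> \<box>\<rightarrow> \<gamma>))))"

definition satisfies_C :: "('v fm set \<Rightarrow> 'v fm \<Rightarrow> bool) \<Rightarrow> bool" where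
  "satisfies_C D \<longleftrightarrow> (\<forall>\<phi> \<psi> \<gamma>. D {\<phi> \<^bold>\<rightarrow> \<psi>} ((\<gamma> \<box>\<rightarrow> \<phi>) \<^bold>\<rightarrow> (\<gamma> \<box>\<rightarrow> \<psi>)))"

definition satisfies_wC :: "('v fm set \<Rightarrow> 'v fm \<Rightarrow> bool) \<Rightarrow> bool" where
  "satisfies_wC D \<longleftrightarrow>
     (\<forall>\<phi> \<psi> \<gamma>. D {} (\<phi> \<^bold>\<rightarrow> \<psi>) \<longrightarrow> D {} ((\<gamma> \<box>\<rightarrow> \<phi>) \<^bold>\<rightarrow> (\<gamma> \<box>\<rightarrow> \<psi>)))"

definition satisfies_DWC2 :: "('v fm set \<Rightarrow> 'v fm \<Rightarrow> bool) \<Rightarrow> bool" where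
  "satisfies_DWC2 D \<longleftrightarrow> (\<forall>\<phi>\<^sub>1 \<phi>\<^sub>2 \<psi> \<gamma>.
     D {(\<phi>\<^sub>1 \<^bold>\<and> \<phi>\<^sub>2) \<^bold>\<rightarrow> \<psi>} (((\<gamma> \<box>\<rightarrow> \<phi>\<^sub>1) \<^bold>\<and> (\<gamma> \<box>\<rightarrow> \<phi>\<^sub>2)) \<^bold>\<rightarrow> (\<gamma> \<box>\<rightarrow> \<psi>)))"

definition satisfies_wDWC2 :: "('v fm set \<Rightarrow> 'v fm \<Rightarrow> bool) \<Rightarrow> bool" where
  "satisfies_wDWC2 D \<longleftrightarrow> (\<forall>\<phi>\<^sub>1 \<phi>\<^sub>2 \<psi> \<gamma>.
     D {} ((\<phi>\<^sub>1 \<^bold>\<and> \<phi>\<^sub>2) \<^bold>\<rightarrow> \<psi>) \<longrightarrow>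
     D {} (((\<gamma> \<box>\<rightarrow> \<phi>\<^sub>1) \<^bold>\<and> (\<gamma> \<box>\<rightarrow> \<phi>\<^sub>2)) \<^bold>\<rightarrow> (\<gamma> \<box>\<rightarrow> \<psi>)))"

end

theory Submission
  imports Defs
begin

text \<open>
  Over intuitionistic conjunction and implication, (C) or (wC)
  precomposed with the direction \<open>((\<gamma> \<box>\<rightarrow> \<phi>\<^sub>1) \<^bold>\<and> (\<gamma> \<box>\<rightarrow> \<phi>\<^sub>2)) \<^bold>\<rightarrow> (\<gamma> \<box>\<rightarrow> (\<phi>\<^sub>1 \<^bold>\<and> \<phi>\<^sub>2))\<close> of (L4) is the
  two-premise rule. Conversely, the two-premise rule with \<open>\<phi>\<^sub>1 = \<phi>\<^sub>2\<close> yields the one-premise rule,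
  which applied to the projections gives one half of (L4); the other half is the two-premise rule
  applied to the identity on \<open>\<phi>\<^sub>1 \<^bold>\<and> \<phi>\<^sub>2\<close>.
\<close>

locale classical_system = logical_system D for D :: "'v fm set \<Rightarrow> 'v fm \<Rightarrow> bool" +
  assumes classical: "satisfies_classical D"
    and MP: "satisfies_MP D"
begin

lemma ax: "classical_axiom \<phi> \<Longrightarrow> D \<Gamma> \<phi>"
  using classical monotonicity[of "{}"] unfolding satisfies_classical_def by blast

lemma mp: "D \<Gamma> (\<phi> \<^bold>\<rightarrow> \<psi>) \<Longrightarrow> D \<Gamma> \<phi> \<Longrightarrow> D \<Gamma> \<psi>"
  using MP cut[of "{\<phi>, \<phi> \<^bold>\<rightarrow> \<psi>}" \<Gamma> \<psi>] unfolding satisfies_MP_def by blast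

lemma imp_weaken: "D \<Gamma> \<psi> \<Longrightarrow> D \<Gamma> (\<phi> \<^bold>\<rightarrow> \<psi>)"
  by (rule mp[OF ax[OF Impl_K]])

text \<open>Modus ponens under an antecedent, read off the S axiom. The deduction theorem is not
  among the assumptions on \<open>D\<close>, so hypothetical reasoning is carried inside
  implications by this lemma and \<open>imp_weaken\<close>.\<close>

lemma imp_mp: "D \<Gamma> (\<phi> \<^bold>\<rightarrow> \<psi> \<^bold>\<rightarrow> \<gamma>) \<Longrightarrow> D \<Gamma> (\<phi> \<^bold>\<rightarrow> \<psi>) \<Longrightarrow> D \<Gamma> (\<phi> \<^bold>\<rightarrow> \<gamma>)"
  by (rule mp[OF mp[OF ax[OF Impl_S]]])

lemma imp_trans: "D \<Gamma> (\<phi> \<^bold>\<rightarrow> \<psi>) \<Longrightarrow> D \<Gamma> (\<psi> \<^bold>\<rightarrow> \<gamma>) \<Longrightarrow> D \<Gamma> (\<phi> \<^bold>\<rightarrow> \<gamma>)"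
  by (rule imp_mp[OF imp_weaken])

lemma imp_refl: "D \<Gamma> (\<phi> \<^bold>\<rightarrow> \<phi>)"
  by (rule imp_mp[OF ax[OF Impl_K] ax[OF Impl_K]])

lemma conj_intro: "D \<Gamma> \<phi> \<Longrightarrow> D \<Gamma> \<psi> \<Longrightarrow> D \<Gamma> (\<phi> \<^bold>\<and> \<psi>)"
  by (rule mp[OF mp[OF ax[OF Conj_I]]])

lemma imp_conj: "D \<Gamma> (\<gamma> \<^bold>\<rightarrow> \<phi>) \<Longrightarrow> D \<Gamma> (\<gamma> \<^bold>\<rightarrow> \<psi>) \<Longrightarrow> D \<Gamma> (\<gamma> \<^bold>\<rightarrow> \<phi> \<^bold>\<and> \<psi>)"
  by (rule imp_mp[OF imp_trans[OF _ ax[OF Conj_I]]])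

text \<open>Cut gives one direction and the context \<open>{\<phi>}\<close> the other. This puts (C)
  and (DWC2) in the shape of (wC) and (wDWC2), with an arbitrary context in place of the empty
  one.\<close>

lemma rule_iff: "D {\<phi>} \<psi> \<longleftrightarrow> (\<forall>\<Gamma>. D \<Gamma> \<phi> \<longrightarrow> D \<Gamma> \<psi>)"
proof
  show "\<forall>\<Gamma>. D \<Gamma> \<phi> \<longrightarrow> D \<Gamma> \<psi>" if "D {\<phi>} \<psi>"
    using cut[OF _ that] by simp
qed (simp add: reflexivity)

lemma satisfies_C_iff:
  "satisfies_C D \<longleftrightarrow>
    (\<forall>\<phi> \<psi> \<gamma> \<Gamma>. D \<Gamma> (\<phi> \<^bold>\<rightarrow> \<psi>) \<longrightarrow> D \<Gamma> ((\<gamma> \<box>\<rightarrow> \<phi>) \<^bold>\<rightarrow> (\<gamma> \<box>\<rightarrow> \<psi>)))"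
  unfolding satisfies_C_def by (simp only: rule_iff)

lemma satisfies_DWC2_iff:
  "satisfies_DWC2 D \<longleftrightarrow>
    (\<forall>\<phi>\<^sub>1 \<phi>\<^sub>2 \<psi> \<gamma> \<Gamma>. D \<Gamma> ((\<phi>\<^sub>1 \<^bold>\<and> \<phi>\<^sub>2) \<^bold>\<rightarrow> \<psi>) \<longrightarrow>
      D \<Gamma> (((\<gamma> \<box>\<rightarrow> \<phi>\<^sub>1) \<^bold>\<and> (\<gamma> \<box>\<rightarrow> \<phi>\<^sub>2)) \<^bold>\<rightarrow> (\<gamma> \<box>\<rightarrow> \<psi>)))"
  unfolding satisfies_DWC2_def by (simp only: rule_iff)

text \<open>The rule \<open>C\<close> is assumed only at the one context \<open>\<Gamma>\<close> of
  the conclusion. Hence \<open>\<Gamma> = {}\<close> serves the weak rules and arbitrary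
  \<open>\<Gamma>\<close> the strong ones; the converse lemma below is parametrized in the same
  way.\<close>

lemma two_premise_rule_if_one_premise_rule:
  assumes L4: "satisfies_L4 D"
    and C: "\<And>\<phi> \<psi> \<gamma>. D \<Gamma> (\<phi> \<^bold>\<rightarrow> \<psi>) \<Longrightarrow> D \<Gamma> ((\<gamma> \<box>\<rightarrow> \<phi>) \<^bold>\<rightarrow> (\<gamma> \<box>\<rightarrow> \<psi>))"
    and "D \<Gamma> ((\<phi>\<^sub>1 \<^bold>\<and> \<phi>\<^sub>2) \<^bold>\<rightarrow> \<psi>)"
  shows "D \<Gamma> (((\<gamma> \<box>\<rightarrow> \<phi>\<^sub>1) \<^bold>\<and> (\<gamma> \<box>\<rightarrow> \<phi>\<^sub>2)) \<^bold>\<rightarrow> (\<gamma> \<box>\<rightarrow> \<psi>))"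
proof (rule imp_trans)
  have "D \<Gamma> ((\<gamma> \<box>\<rightarrow> (\<phi>\<^sub>1 \<^bold>\<and> \<phi>\<^sub>2)) \<^bold>\<leftrightarrow> ((\<gamma> \<box>\<rightarrow> \<phi>\<^sub>1) \<^bold>\<and> (\<gamma> \<box>\<rightarrow> \<phi>\<^sub>2)))"
    using L4 monotonicity[of "{}"] unfolding satisfies_L4_def by blast
  then show "D \<Gamma> ((\<gamma> \<box>\<rightarrow> \<phi>\<^sub>1) \<^bold>\<and> (\<gamma> \<box>\<rightarrow> \<phi>\<^sub>2) \<^bold>\<rightarrow> (\<gamma> \<box>\<rightarrow> (\<phi>\<^sub>1 \<^bold>\<and> \<phi>\<^sub>2)))"
    by (rule mp[OF ax[OF Conj_E2]])
qed (rule C[OF assms(3)])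

lemma one_premise_rule_if_two_premise_rule:
  assumes DWC: "\<And>\<phi>\<^sub>1 \<phi>\<^sub>2 \<psi> \<gamma>. D \<Gamma> ((\<phi>\<^sub>1 \<^bold>\<and> \<phi>\<^sub>2) \<^bold>\<rightarrow> \<psi>) \<Longrightarrow>
      D \<Gamma> (((\<gamma> \<box>\<rightarrow> \<phi>\<^sub>1) \<^bold>\<and> (\<gamma> \<box>\<rightarrow> \<phi>\<^sub>2)) \<^bold>\<rightarrow> (\<gamma> \<box>\<rightarrow> \<psi>))"
    and "D \<Gamma> (\<phi> \<^bold>\<rightarrow> \<psi>)"
  shows "D \<Gamma> ((\<gamma> \<box>\<rightarrow> \<phi>) \<^bold>\<rightarrow> (\<gamma> \<box>\<rightarrow> \<psi>))"
proof (rule imp_trans)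
  show "D \<Gamma> ((\<gamma> \<box>\<rightarrow> \<phi>) \<^bold>\<rightarrow> (\<gamma> \<box>\<rightarrow> \<phi>) \<^bold>\<and> (\<gamma> \<box>\<rightarrow> \<phi>))"
    by (rule imp_conj[OF imp_refl imp_refl])
  show "D \<Gamma> ((\<gamma> \<box>\<rightarrow> \<phi>) \<^bold>\<and> (\<gamma> \<box>\<rightarrow> \<phi>) \<^bold>\<rightarrow> (\<gamma> \<box>\<rightarrow> \<psi>))"
    by (rule DWC[OF imp_trans[OF ax[OF Conj_E1] assms(2)]])
qed

lemma wC_if_wDWC2: "satisfies_wDWC2 D \<Longrightarrow> satisfies_wC D"
  unfolding satisfies_wC_def satisfies_wDWC2_def
  by (intro allI impI, rule one_premise_rule_if_two_premise_rule[of "{}"]) blast+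

text \<open>Since (L4) speaks of theorems, the two-premise rule is applied only to classical
  theorems. The weak rule therefore suffices, and the lemma serves both equivalences.\<close>

lemma L4_if_wDWC2:
  assumes "satisfies_wDWC2 D"
  shows "satisfies_L4 D"
proof -
  have C: "D {} (\<phi> \<^bold>\<rightarrow> \<psi>) \<Longrightarrow> D {} ((\<gamma> \<box>\<rightarrow> \<phi>) \<^bold>\<rightarrow> (\<gamma> \<box>\<rightarrow> \<psi>))" for \<phi> \<psi> \<gamma>
    using wC_if_wDWC2[OF assms] unfolding satisfies_wC_def by blast
  have DWC: "D {} ((\<phi> \<box>\<rightarrow> \<psi>) \<^bold>\<and> (\<phi> \<box>\<rightarrow> \<gamma>) \<^bold>\<rightarrow> (\<phi> \<box>\<rightarrow> (\<psi> \<^bold>\<and> \<gamma>)))" for \<phi> \<psi> \<gamma>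
    using assms unfolding satisfies_wDWC2_def by (simp add: imp_refl)
  show ?thesis
    unfolding satisfies_L4_def
    \<comment> \<open>After the biconditional is split, \<open>imp_conj\<close> reduces its forward
      half to the two projections, which \<open>C\<close> lifts to the consequents;
      \<open>DWC\<close> is the backward half.\<close>
    by (intro allI conj_intro imp_conj C[OF ax] DWC Conj_E1 Conj_E2)
qed

lemma wDWC2_if_DWC2: "satisfies_DWC2 D \<Longrightarrow> satisfies_wDWC2 D"
  unfolding satisfies_DWC2_iff satisfies_wDWC2_def by blast

lemma L4_C_iff_DWC2: "satisfies_L4 D \<and> satisfies_C D \<longleftrightarrow> satisfies_DWC2 D"
proof
  show "satisfies_DWC2 D" if "satisfies_L4 D \<and> satisfies_C D"
    unfolding satisfies_DWC2_iff
  proof (intro allI impI)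
    fix \<phi>\<^sub>1 \<phi>\<^sub>2 \<psi> \<gamma> \<Gamma>
    assume "D \<Gamma> (\<phi>\<^sub>1 \<^bold>\<and> \<phi>\<^sub>2 \<^bold>\<rightarrow> \<psi>)"
    then show "D \<Gamma> ((\<gamma> \<box>\<rightarrow> \<phi>\<^sub>1) \<^bold>\<and> (\<gamma> \<box>\<rightarrow> \<phi>\<^sub>2) \<^bold>\<rightarrow> (\<gamma> \<box>\<rightarrow> \<psi>))"
      \<comment> \<open>The rotation puts the premise about \<open>\<psi>\<close> first, so that the
        chained fact meets it rather than (L4).\<close>
      by (rule two_premise_rule_if_one_premise_rule[rotated 2])
        (use that in \<open>simp_all add: satisfies_C_iff\<close>)
  qed
  show "satisfies_L4 D \<and> satisfies_C D" if DWC: "satisfies_DWC2 D"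
  proof
    show "satisfies_L4 D"
      by (rule L4_if_wDWC2[OF wDWC2_if_DWC2[OF DWC]])
    show "satisfies_C D"
      unfolding satisfies_C_iff
      by (intro allI impI, rule one_premise_rule_if_two_premise_rule)
        (use DWC in \<open>simp_all add: satisfies_DWC2_iff\<close>)
  qed
qed

lemma L4_wC_iff_wDWC2: "satisfies_L4 D \<and> satisfies_wC D \<longleftrightarrow> satisfies_wDWC2 D"
proof
  show "satisfies_wDWC2 D" if "satisfies_L4 D \<and> satisfies_wC D"
    unfolding satisfies_wDWC2_def
  proof (intro allI impI)
    fix \<phi>\<^sub>1 \<phi>\<^sub>2 \<psi> \<gamma>
    assume "D {} (\<phi>\<^sub>1 \<^bold>\<and> \<phi>\<^sub>2 \<^bold>\<rightarrow> \<psi>)"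
    then show "D {} ((\<gamma> \<box>\<rightarrow> \<phi>\<^sub>1) \<^bold>\<and> (\<gamma> \<box>\<rightarrow> \<phi>\<^sub>2) \<^bold>\<rightarrow> (\<gamma> \<box>\<rightarrow> \<psi>))"
      by (rule two_premise_rule_if_one_premise_rule[rotated 2])
        (use that in \<open>simp_all add: satisfies_wC_def\<close>)
  qed
qed (simp add: L4_if_wDWC2 wC_if_wDWC2)

end

theorem theorem3p6:
  fixes D :: "'v fm set \<Rightarrow> 'v fm \<Rightarrow> bool"
  assumes "logical_system D" and "satisfies_classical D" and "satisfies_MP D"
  shows "((satisfies_L1 D \<and> satisfies_L2 D \<and> satisfies_L3 D \<and> satisfies_L4 D \<and> satisfies_C D)
            \<longleftrightarrow> (satisfies_L1 D \<and> satisfies_L2 D \<and> satisfies_L3 D \<and> satisfies_DWC2 D))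
       \<and> ((satisfies_L1 D \<and> satisfies_L2 D \<and> satisfies_L3 D \<and> satisfies_L4 D \<and> satisfies_wC D)
            \<longleftrightarrow> (satisfies_L1 D \<and> satisfies_L2 D \<and> satisfies_L3 D \<and> satisfies_wDWC2 D))"
proof -
  interpret classical_system D
    using assms by (simp add: classical_system_def classical_system_axioms_def)
  show ?thesis
    \<comment> \<open>(L1)-(L3) stand on both sides, so it is enough to exchange (L4) and the
      one-premise rule for the two-premise rule.\<close>
    using L4_C_iff_DWC2 L4_wC_iff_wDWC2 by blast
qed

end
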